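(* Let $(M,g)$ be the Robinson–Trautman spacetime with coordinates $(t,r,x,y)$, constants $a,b,d\in\mathbb R$ and function $f=f(x,y)$, and let $F_1=f_x^2+f_y^2-f(f_{xx}+f_{yy})$. If $F_1-2a+4br\neq0$ on $M$, then for all constants $\mu_1,\mu_2\in\mathbb R$ the spacetime admits generalized Ricci inheritance with respect to the vector field $\xi=\mu_1\frac{\partial}{\partial x}+\mu_2\frac{\partial}{\partial y}$, namely $$\mathscr L_\xi S=\lambda_S S+\lambda_g g,$$ where $$\lambda_S=-\frac{\mu_2F_{13}+\mu_1F_{11}}{f(2a-4br-F_1)},\qquad \lambda_g=-\frac{4b(\mu_2F_{13}+\mu_1F_{11})}{rf(2a-4br-F_1)},$$ $$F_{13}=-2f_y^3+f_y\{4a-16br-2f_x^2+f(3f_{yy}+f_{xx})\}-f\{-2f_xf_{xy}+f(f_{yyy}+f_{xxy})\},$$ $$F_{11}=-2f_x^3+f_x\{4a-16br-2f_y^2+f(f_{yy}+3f_{xx})\}-f\{-2f_yf_{xy}+f(f_{xxx}+f_{xyy})\}.$$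
   Context: Robinson–Trautman (RT) spacetime: $a,b,d\in\mathbb R$ are constants; $M=I\times J\times\Omega$ with coordinates $(x^1,x^2,x^3,x^4)=(t,r,x,y)$, where $I\subset\mathbb R$ and $J\subset\mathbb R\setminus\{0\}$ are open intervals and $\Omega\subset\mathbb R^2$ is open, connected and nonempty; $f:\Omega\to\mathbb R$ is smooth and nowhere vanishing, with subscripts denoting partial derivatives; the metric is $$g=-2\Big(a-2br-\frac dr\Big)dt^2+2\,dt\,dr-\frac{r^2}{f^2}(dx^2+dy^2).$$ ($2\,dt\,dr$ means $g_{12}=g_{21}=1$.) Curvature conventions: with $\Gamma$ the Levi-Civita connection coefficients, $R_{pqrs}=g_{p\alpha}(\partial_r\Gamma^\alpha_{qs}-\partial_s\Gamma^\alpha_{qr}+\Gamma^\beta_{qs}\Gamma^\alpha_{\beta r}-\Gamma^\beta_{qr}\Gamma^\alpha_{\beta s})$ and $S_{qr}=g^{ps}R_{pqrs}$. With this convention the nonzero components of $S$ (up to symmetry) are $S_{11}=-\frac{8b(d+r(-a+2br))}{r^2}$, $S_{12}=-\frac{4b}{r}$, $S_{33}=S_{44}=\frac{F_1-2a+8br}{f^2}$. Generalized Ricci inheritance with respect to $\xi$ means $\mathscr L_\xi S=\lambda_S S+\lambda_g g$ for smooth functions $\lambda_S,\lambda_g$, where $\mathscr L_\xi$ is the Lie derivative. *)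

theory Defs
  imports "HOL-Analysis.Analysis"
begin

section \<open>Partial derivatives and smoothness\<close>

definition partial :: "'n::finite \<Rightarrow> (real^'n \<Rightarrow> real) \<Rightarrow> real^'n \<Rightarrow> real" where
  "partial i f p = deriv (\<lambda>h. f (p + h *\<^sub>R axis i 1)) 0"

text \<open>Indices are processed from left to right, as in subscript notation:
  \<open>pd [1,1,2] f\<close> is $f_{xxy}$, i.e. \<open>partial 2 (partial 1 (partial 1 f))\<close>.\<close>

definition pd :: "'n::finite list \<Rightarrow> (real^'n \<Rightarrow> real) \<Rightarrow> real^'n \<Rightarrow> real" where
  "pd is f = fold partial is f"

text \<open>$C^\infty$ on an open set \<open>S\<close>: partial derivatives of all orders (including order
  zero) exist and are differentiable.\<close>

definition smooth_on :: "(real^'n::finite) set \<Rightarrow> (real^'n \<Rightarrow> real) \<Rightarrow> bool" where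
  "smooth_on S f \<longleftrightarrow> (\<forall>is. pd is f differentiable_on S)"


section \<open>Curvature and Lie derivative in coordinates\<close>

text \<open>A covariant 2-tensor field on an open subset of $\mathbb R^n$ is given by its matrix of
  components at each point, a vector field by its vector of components.\<close>

type_synonym 'n tensor2 = "real^'n \<Rightarrow> real^'n^'n"

text \<open>\<open>christoffel g k i j\<close> is $\Gamma^k_{ij}$.\<close>

definition christoffel :: "'n::finite tensor2 \<Rightarrow> 'n \<Rightarrow> 'n \<Rightarrow> 'n \<Rightarrow> real^'n \<Rightarrow> real" where
  "christoffel g k i j p =
     (1/2) * (\<Sum>l\<in>UNIV. matrix_inv (g p) $ k $ l *
       (partial i (\<lambda>u. g u $ l $ j) p + partial j (\<lambda>u. g u $ l $ i) p
        - partial l (\<lambda>u. g u $ i $ j) p))"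

text \<open>The order of the indices fixes the sign: with these conventions \<open>ricci\<close> is the negative of
  the trace of \<open>riemann\<close> over its first and third index.\<close>

definition riemann :: "'n::finite tensor2 \<Rightarrow> 'n \<Rightarrow> 'n \<Rightarrow> 'n \<Rightarrow> 'n \<Rightarrow> real^'n \<Rightarrow> real" where
  "riemann g p q r s u =
     (\<Sum>\<alpha>\<in>UNIV. g u $ p $ \<alpha> *
       (partial r (christoffel g \<alpha> q s) u - partial s (christoffel g \<alpha> q r) u
        + (\<Sum>\<beta>\<in>UNIV. christoffel g \<beta> q s u * christoffel g \<alpha> \<beta> r u)
        - (\<Sum>\<beta>\<in>UNIV. christoffel g \<beta> q r u * christoffel g \<alpha> \<beta> s u)))"

definition ricci :: "'n::finite tensor2 \<Rightarrow> 'n tensor2" where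
  "ricci g u = (\<chi> q r. \<Sum>p\<in>UNIV. \<Sum>s\<in>UNIV. matrix_inv (g u) $ p $ s * riemann g p q r s u)"

definition lie_derivative :: "(real^'n \<Rightarrow> real^'n::finite) \<Rightarrow> 'n tensor2 \<Rightarrow> 'n tensor2" where
  "lie_derivative \<xi> T p = (\<chi> i j. \<Sum>k\<in>UNIV.
      \<xi> p $ k * partial k (\<lambda>u. T u $ i $ j) p
      + T p $ k $ j * partial i (\<lambda>u. \<xi> u $ k) p
      + T p $ i $ k * partial j (\<lambda>u. \<xi> u $ k) p)"

definition generalized_ricci_inheritance ::
    "(real^'n::finite) set \<Rightarrow> 'n tensor2 \<Rightarrow> (real^'n \<Rightarrow> real^'n) \<Rightarrow>
     (real^'n \<Rightarrow> real) \<Rightarrow> (real^'n \<Rightarrow> real) \<Rightarrow> bool" where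
  "generalized_ricci_inheritance M g \<xi> ls lg \<longleftrightarrow>
     smooth_on M ls \<and> smooth_on M lg \<and>
     (\<forall>p\<in>M. lie_derivative \<xi> (ricci g) p = ls p *\<^sub>R ricci g p + lg p *\<^sub>R g p)"


section \<open>Robinson--Trautman spacetime\<close>

text \<open>The coordinates $(t,r,x,y)$ of a point \<open>p\<close> are \<open>p $ 1\<close>, \<open>p $ 2\<close>, \<open>p $ 3\<close>, \<open>p $ 4\<close>.\<close>

definition xy_part :: "real^4 \<Rightarrow> real^2" where
  "xy_part p = vector [p $ 3, p $ 4]"

definition RT_manifold :: "real set \<Rightarrow> real set \<Rightarrow> (real^2) set \<Rightarrow> (real^4) set" where
  "RT_manifold I J \<Omega> = {p. p $ 1 \<in> I \<and> p $ 2 \<in> J \<and> xy_part p \<in> \<Omega>}"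

definition RT_metric :: "real \<Rightarrow> real \<Rightarrow> real \<Rightarrow> (real^2 \<Rightarrow> real) \<Rightarrow> 4 tensor2" where
  "RT_metric a b d f p =
     (let r = p $ 2; h = - (r\<^sup>2 / (f (xy_part p))\<^sup>2) in
      vector [vector [- 2 * (a - 2 * b * r - d / r), 1, 0, 0],
              vector [1, 0, 0, 0],
              vector [0, 0, h, 0],
              vector [0, 0, 0, h]])"

definition RT_F1 :: "(real^2 \<Rightarrow> real) \<Rightarrow> real^2 \<Rightarrow> real" where
  "RT_F1 f q = (pd [1] f q)\<^sup>2 + (pd [2] f q)\<^sup>2 - f q * (pd [1,1] f q + pd [2,2] f q)"

definition RT_F13 :: "real \<Rightarrow> real \<Rightarrow> (real^2 \<Rightarrow> real) \<Rightarrow> real \<Rightarrow> real^2 \<Rightarrow> real" where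
  "RT_F13 a b f r q =
     - 2 * (pd [2] f q)^3
     + pd [2] f q * (4 * a - 16 * b * r - 2 * (pd [1] f q)\<^sup>2
                     + f q * (3 * pd [2,2] f q + pd [1,1] f q))
     - f q * (- 2 * pd [1] f q * pd [1,2] f q + f q * (pd [2,2,2] f q + pd [1,1,2] f q))"

definition RT_F11 :: "real \<Rightarrow> real \<Rightarrow> (real^2 \<Rightarrow> real) \<Rightarrow> real \<Rightarrow> real^2 \<Rightarrow> real" where
  "RT_F11 a b f r q =
     - 2 * (pd [1] f q)^3
     + pd [1] f q * (4 * a - 16 * b * r - 2 * (pd [2] f q)\<^sup>2
                     + f q * (pd [2,2] f q + 3 * pd [1,1] f q))
     - f q * (- 2 * pd [2] f q * pd [1,2] f q + f q * (pd [1,1,1] f q + pd [1,2,2] f q))"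

end

theory Submission
  imports Defs
begin

text \<open>The Ricci tensor $S$ and the metric $g$ are both block diagonal. On the \<open>t, r\<close> block they
  are proportional, $S = -\frac{4b}{r}\,g$, and on the \<open>x, y\<close> block both are multiples of the identity,
  $S_{33} = S_{44} = (F_1 - 2a + 8br)/f^2$ and $g_{33} = g_{44} = -r^2/f^2$. The field
  $\xi = \mu_1\partial_x + \mu_2\partial_y$ has constant coefficients, so the Lie derivative only
  differentiates the components of $S$, and among them only $S_{33} = S_{44}$ depend on $x$ and $y$.

  Thus $\mathscr L_\xi S$ vanishes on the \<open>t, r\<close> block, which is matched by
  $\lambda_g = \frac{4b}{r}\lambda_S$. On the \<open>x, y\<close> block there remains the scalar equation
  $\xi(S_{33}) = \lambda_S (F_1 - 2a + 4br)/f^2$, which determines $\lambda_S$ because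
  $F_1 - 2a + 4br$ has no zero; the quotient rule gives
  $\partial_x S_{33} = F_{11}/f^3$ and $\partial_y S_{33} = F_{13}/f^3$.

  What has to be supplied is the Ricci tensor in closed form (\<open>ricci_eq\<close>), obtained from a table of
  the Christoffel symbols (\<open>christoffel_eq\<close>), and these two derivatives (\<open>transverse_ricci_partials\<close>).
  Both use the symmetry of mixed partial derivatives (\<open>partial_commute\<close>). Smoothness of the two
  coefficients follows since smooth functions are closed under arithmetic operations with nonzero
  denominators and under composition with the projection to the \<open>x, y\<close> plane.\<close>

section \<open>Calculus of coordinate partial derivatives\<close>

text \<open>\<^const>\<open>partial\<close> is total, so it says nothing about existence. This relation records that
  the derivative along the axis exists, which is what the rules for sums, products and quotients
  of one-variable derivatives need.\<close>

definition has_partial :: "(real^'n::finite \<Rightarrow> real) \<Rightarrow> 'n \<Rightarrow> real \<Rightarrow> real^'n \<Rightarrow> bool" where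
  "has_partial f i D p \<longleftrightarrow> ((\<lambda>h. f (p + h *\<^sub>R axis i 1)) has_field_derivative D) (at 0)"

lemma has_partial_imp_partial: "has_partial f i D p \<Longrightarrow> partial i f p = D"
  unfolding has_partial_def partial_def by (rule DERIV_imp_deriv)

lemma has_derivative_imp_has_partial:
  assumes "(f has_derivative L) (at p)"
  shows "has_partial f i (L (axis i 1)) p"
proof -
  have "((\<lambda>h. p + h *\<^sub>R axis i 1) has_derivative (\<lambda>h. h *\<^sub>R axis i 1)) (at (0::real))"
    by (auto intro!: derivative_eq_intros)
  moreover have "(f has_derivative L) (at (p + 0 *\<^sub>R axis i 1))"
    using assms by simp
  ultimately have "((\<lambda>h. f (p + h *\<^sub>R axis i 1)) has_derivative (\<lambda>h. L (h *\<^sub>R axis i 1))) (at 0)"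
    by (rule has_derivative_compose)
  moreover have "L (h *\<^sub>R axis i 1) = L (axis i 1) * h" for h
    using linear_scale[OF has_derivative_linear[OF assms]] by simp
  ultimately show ?thesis
    by (simp add: has_partial_def has_field_derivative_def)
qed

lemma has_derivative_imp_partial:
  "(f has_derivative L) (at p) \<Longrightarrow> partial i f p = L (axis i 1)"
  by (intro has_partial_imp_partial has_derivative_imp_has_partial)

lemma differentiable_imp_has_partial:
  "f differentiable at p \<Longrightarrow> has_partial f i (partial i f p) p"
  using has_derivative_imp_has_partial has_partial_imp_partial
  unfolding differentiable_def by metis

lemma differentiable_imp_has_derivative_along_axis:
  assumes "f differentiable at (c + s *\<^sub>R axis i 1)"
  shows "((\<lambda>s. f (c + s *\<^sub>R axis i 1)) has_field_derivative partial i f (c + s *\<^sub>R axis i 1)) (at s)"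
proof -
  have "((\<lambda>h. f (c + (h + s) *\<^sub>R axis i 1)) has_field_derivative partial i f (c + s *\<^sub>R axis i 1)) (at 0)"
    using differentiable_imp_has_partial[OF assms, of i]
    by (simp add: has_partial_def algebra_simps)
  then show ?thesis
    using DERIV_shift[of "\<lambda>s. f (c + s *\<^sub>R axis i 1)" _ 0 s] by simp
qed

lemma partial_const [simp]: "partial i (\<lambda>u. c) p = 0"
  by (simp add: partial_def)

lemma partial_nth: "partial i (\<lambda>u. u $ j) p = (if i = j then 1 else 0)"
proof -
  have "((\<lambda>u. u $ j) has_derivative (\<lambda>v. v $ j)) (at p)"
    by (rule bounded_linear_imp_has_derivative[OF bounded_linear_vec_nth])
  then show ?thesis
    by (auto dest!: has_derivative_imp_partial[of _ _ _ i] simp: axis_def)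
qed

lemma partial_add:
  assumes "f differentiable at p" "g differentiable at p"
  shows "partial i (\<lambda>u. f u + g u) p = partial i f p + partial i g p"
  using assms[THEN differentiable_imp_has_partial, of i]
  by (auto intro!: has_partial_imp_partial derivative_eq_intros simp: has_partial_def)

lemma partial_minus:
  assumes "f differentiable at p"
  shows "partial i (\<lambda>u. - f u) p = - partial i f p"
  using assms[THEN differentiable_imp_has_partial, of i]
  by (auto intro!: has_partial_imp_partial derivative_eq_intros simp: has_partial_def)

lemma partial_diff:
  assumes "f differentiable at p" "g differentiable at p"
  shows "partial i (\<lambda>u. f u - g u) p = partial i f p - partial i g p"
  using assms[THEN differentiable_imp_has_partial, of i]
  by (auto intro!: has_partial_imp_partial derivative_eq_intros simp: has_partial_def)

lemma partial_mult:
  assumes "f differentiable at p" "g differentiable at p"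
  shows "partial i (\<lambda>u. f u * g u) p = partial i f p * g p + f p * partial i g p"
  using assms[THEN differentiable_imp_has_partial, of i]
  by (auto intro!: has_partial_imp_partial derivative_eq_intros simp: has_partial_def)

lemma partial_divide:
  assumes "f differentiable at p" "g differentiable at p" "g p \<noteq> 0"
  shows "partial i (\<lambda>u. f u / g u) p = (partial i f p * g p - f p * partial i g p) / (g p)\<^sup>2"
  using assms(1,2)[THEN differentiable_imp_has_partial, of i] assms(3)
  by (auto intro!: has_partial_imp_partial derivative_eq_intros simp: has_partial_def power2_eq_square)

lemma partial_power2:
  assumes "f differentiable at p"
  shows "partial i (\<lambda>u. (f u)\<^sup>2) p = 2 * f p * partial i f p"
  using partial_mult[OF assms assms] by (simp add: power2_eq_square)

text \<open>Partial derivatives are local: equality on an open set, not just at the point, is what allows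
  the coefficients of the connection and of the Ricci tensor to be replaced by closed formulas
  before they are differentiated.\<close>

lemma partial_cong:
  assumes "open S" "p \<in> S" and eq: "\<And>u. u \<in> S \<Longrightarrow> f u = g u"
  shows "partial i f p = partial i g p"
proof -
  have "((\<lambda>h. p + h *\<^sub>R axis i 1) \<longlongrightarrow> p + 0 *\<^sub>R axis i 1) (nhds (0::real))"
    by (intro tendsto_intros filterlim_ident)
  then have "\<forall>\<^sub>F h in nhds (0::real). p + h *\<^sub>R axis i 1 \<in> S"
    using assms(1,2) by (auto dest: topological_tendstoD)
  then have "\<forall>\<^sub>F h in nhds (0::real). f (p + h *\<^sub>R axis i 1) = g (p + h *\<^sub>R axis i 1)"
    by (rule eventually_mono) (rule eq)
  then show ?thesis
    unfolding partial_def by (rule deriv_cong_ev[OF _ refl])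
qed

lemma pd_Nil [simp]: "pd [] f = f"
  and pd_Cons: "pd (i # is) f = pd is (partial i f)"
  and pd_append: "pd (is @ js) f = pd js (pd is f)"
  by (simp_all add: pd_def)

lemma partial_pd: "partial i (pd is f) = pd (is @ [i]) f"
  by (simp add: pd_def)

lemma pd_cong:
  assumes "open S" and eq: "\<And>u. u \<in> S \<Longrightarrow> f u = g u" and "p \<in> S"
  shows "pd is f p = pd is g p"
  using eq \<open>p \<in> S\<close>
proof (induction "is" arbitrary: f g p)
  case (Cons i "is")
  have "partial i f u = partial i g u" if "u \<in> S" for u
    by (rule partial_cong[OF \<open>open S\<close> that Cons.prems(1)])
  from Cons.IH[OF this Cons.prems(2)] show ?case
    by (simp add: pd_Cons)
qed simp

section \<open>Symmetry of mixed partial derivatives\<close>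

text \<open>The second difference quotient over a small square converges to the mixed derivative. The mean
  value theorem in direction \<open>i\<close> turns the second difference into \<open>h\<close> times a first difference of
  \<open>partial i f\<close>, and total differentiability of \<open>partial i f\<close> at \<open>p\<close> evaluates the latter up to \<open>o(h)\<close>.
  Only \<open>h > 0\<close> is considered, which suffices for uniqueness of the limit.\<close>

lemma second_difference_tendsto:
  fixes f :: "real^'n::finite \<Rightarrow> real" and i j :: 'n
  assumes "open S" "p \<in> S" and f: "\<And>u. u \<in> S \<Longrightarrow> f differentiable at u"
    and "partial i f differentiable at p"
  defines "\<Delta> \<equiv> \<lambda>h. f (p + h *\<^sub>R axis i 1 + h *\<^sub>R axis j 1) - f (p + h *\<^sub>R axis i 1)
                    - f (p + h *\<^sub>R axis j 1) + f p"
  shows "((\<lambda>h. \<Delta> h / h\<^sup>2) \<longlongrightarrow> partial j (partial i f) p) (at_right 0)"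
proof (rule tendstoI)
  fix e :: real assume "e > 0"
  define G where "G = partial i f"
  obtain L where L: "(G has_derivative L) (at p)"
    using assms(4) by (auto simp: G_def differentiable_def)
  have lin: "linear L" by (rule has_derivative_linear[OF L])
  have Lj: "partial j G p = L (axis j 1)"
    by (rule has_derivative_imp_partial[OF L])
  obtain d1 where d1: "d1 > 0" "\<And>u. norm (u - p) < d1 \<Longrightarrow> \<bar>G u - G p - L (u - p)\<bar> \<le> (e/6) * norm (u - p)"
  proof -
    have "e / 6 > 0" using \<open>e > 0\<close> by simp
    then show thesis
      using L that unfolding has_derivative_at_alt real_norm_def by blast
  qed
  obtain d2 where d2: "d2 > 0" "ball p d2 \<subseteq> S"
    using assms(1,2) open_contains_ball by blast
  define D where "D = min d1 d2 / 2"
  have "D > 0" using d1 d2 by (simp add: D_def)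
  have "dist (\<Delta> h / h\<^sup>2) (partial j (partial i f) p) < e" if h: "0 < h" "h < D" for h
  proof -
    have bound: "norm (s *\<^sub>R axis i 1 + t *\<^sub>R axis j 1 :: real^'n) \<le> s + t" if "0 \<le> s" "0 \<le> t" for s t
      using norm_triangle_ineq[of "s *\<^sub>R axis i 1 :: real^'n" "t *\<^sub>R axis j 1"] that by simp
    have small: "norm (s *\<^sub>R axis i 1 + t *\<^sub>R axis j 1 :: real^'n) < min d1 d2"
      if "0 \<le> s" "0 \<le> t" "s \<le> h" "t \<le> h" for s t
      using bound[OF that(1,2)] that(3,4) h by (simp add: D_def)
    have inS: "p + s *\<^sub>R axis i 1 + t *\<^sub>R axis j 1 \<in> S" if "0 \<le> s" "0 \<le> t" "s \<le> h" "t \<le> h" for s t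
    proof -
      have "p + s *\<^sub>R axis i 1 + t *\<^sub>R axis j 1 \<in> ball p d2"
        using small[OF that] unfolding mem_ball dist_commute[of p] by (simp add: dist_norm add.assoc)
      then show ?thesis using d2(2) by blast
    qed
    have G: "\<bar>G (p + s *\<^sub>R axis i 1 + t *\<^sub>R axis j 1) - G p - L (s *\<^sub>R axis i 1 + t *\<^sub>R axis j 1)\<bar> \<le> (e/6) * (s + t)"
      if "0 \<le> s" "0 \<le> t" "s \<le> h" "t \<le> h" for s t
    proof -
      have "\<bar>G (p + s *\<^sub>R axis i 1 + t *\<^sub>R axis j 1) - G p - L (s *\<^sub>R axis i 1 + t *\<^sub>R axis j 1)\<bar>
        \<le> (e/6) * norm (s *\<^sub>R axis i 1 + t *\<^sub>R axis j 1 :: real^'n)"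
        using d1(2)[of "p + s *\<^sub>R axis i 1 + t *\<^sub>R axis j 1"] small[OF that] by (simp add: add.assoc)
      also have "\<dots> \<le> (e/6) * (s + t)"
        using bound[OF that(1,2)] \<open>e > 0\<close> by (intro mult_left_mono) auto
      finally show ?thesis .
    qed
    \<comment> \<open>The second difference is the increment over \<open>[0, h]\<close> of this one-variable function.\<close>
    define \<phi> where "\<phi> = (\<lambda>s. f (p + h *\<^sub>R axis j 1 + s *\<^sub>R axis i 1) - f (p + s *\<^sub>R axis i 1))"
    have d\<phi>: "(\<phi> has_field_derivative
        (G (p + h *\<^sub>R axis j 1 + s *\<^sub>R axis i 1) - G (p + s *\<^sub>R axis i 1))) (at s)"
      if "0 \<le> s" "s \<le> h" for s
    proof -
      have "p + h *\<^sub>R axis j 1 + s *\<^sub>R axis i 1 \<in> S" "p + s *\<^sub>R axis i 1 \<in> S"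
        using inS[of s h] inS[of s 0] that h by (simp_all add: ac_simps)
      from this[THEN f, THEN differentiable_imp_has_derivative_along_axis] show ?thesis
        unfolding \<phi>_def G_def by (rule DERIV_diff)
    qed
    obtain \<xi> where \<xi>: "0 < \<xi>" "\<xi> < h"
      "\<phi> h - \<phi> 0 = (h - 0) * (G (p + h *\<^sub>R axis j 1 + \<xi> *\<^sub>R axis i 1) - G (p + \<xi> *\<^sub>R axis i 1))"
      using MVT2[OF h(1) d\<phi>] by blast
    have "\<Delta> h = \<phi> h - \<phi> 0"
      by (simp add: \<Delta>_def \<phi>_def algebra_simps)
    then have \<Delta>: "\<Delta> h / h\<^sup>2 = (G (p + \<xi> *\<^sub>R axis i 1 + h *\<^sub>R axis j 1) - G (p + \<xi> *\<^sub>R axis i 1)) / h"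
      using \<xi>(3) h by (simp add: power2_eq_square ac_simps)
    have "\<bar>G (p + \<xi> *\<^sub>R axis i 1 + h *\<^sub>R axis j 1) - G (p + \<xi> *\<^sub>R axis i 1) - h * L (axis j 1)\<bar>
        \<le> (e/6) * (\<xi> + h) + (e/6) * (\<xi> + 0)"
    proof -
      have Lst: "L (s *\<^sub>R axis i 1 + t *\<^sub>R axis j 1) = s * L (axis i 1) + t * L (axis j 1)" for s t
        by (simp add: linear_add[OF lin] linear_scale[OF lin])
      show ?thesis
        using G[of \<xi> h, unfolded Lst] G[of \<xi> 0, unfolded Lst] \<xi>(1,2) h(1)
        by (simp only: scaleR_zero_left add_0_right mult_zero_left) linarith
    qed
    \<comment> \<open>Both endpoints of the first difference are within \<open>2 * h\<close> and \<open>h\<close> of \<open>p\<close>, hence the constant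
      \<open>e/6\<close> above: the total error stays at \<open>e/2 < e\<close>.\<close>
    also have "\<dots> \<le> (e/6) * (3 * h)"
      using \<xi> \<open>e > 0\<close> unfolding distrib_left[symmetric] by (intro mult_left_mono) auto
    finally have "\<bar>G (p + \<xi> *\<^sub>R axis i 1 + h *\<^sub>R axis j 1) - G (p + \<xi> *\<^sub>R axis i 1) - h * L (axis j 1)\<bar> / h \<le> e/2"
      using h by (simp add: field_simps)
    moreover have "\<Delta> h / h\<^sup>2 - partial j G p
        = (G (p + \<xi> *\<^sub>R axis i 1 + h *\<^sub>R axis j 1) - G (p + \<xi> *\<^sub>R axis i 1) - h * L (axis j 1)) / h"
      unfolding \<Delta> Lj using h by (simp add: field_simps)
    ultimately have "\<bar>\<Delta> h / h\<^sup>2 - partial j G p\<bar> \<le> e/2"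
      using h by (simp add: abs_divide)
    then show ?thesis
      using \<open>e > 0\<close> by (simp add: dist_norm G_def)
  qed
  then show "\<forall>\<^sub>F h in at_right 0. dist (\<Delta> h / h\<^sup>2) (partial j (partial i f) p) < e"
    using \<open>D > 0\<close> unfolding eventually_at_right_field by (metis)
qed

text \<open>The second difference is symmetric in the two directions, so the two mixed derivatives are
  limits of the same quotient.\<close>

lemma partial_commute:
  fixes f :: "real^'n::finite \<Rightarrow> real"
  assumes "open S" "p \<in> S" "\<And>u. u \<in> S \<Longrightarrow> f differentiable at u"
    and "partial i f differentiable at p" "partial j f differentiable at p"
  shows "partial j (partial i f) p = partial i (partial j f) p"
proof -
  let ?\<Delta> = "\<lambda>i j h. f (p + h *\<^sub>R axis i 1 + h *\<^sub>R axis j 1) - f (p + h *\<^sub>R axis i 1)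
                    - f (p + h *\<^sub>R axis j 1) + f p"
  have "(\<lambda>h. ?\<Delta> j i h / h\<^sup>2) = (\<lambda>h. ?\<Delta> i j h / h\<^sup>2)" by (simp add: algebra_simps)
  then have "((\<lambda>h. ?\<Delta> i j h / h\<^sup>2) \<longlongrightarrow> partial i (partial j f) p) (at_right 0)"
    using second_difference_tendsto[OF assms(1-3,5), where j = i] by (simp only:)
  with second_difference_tendsto[OF assms(1-4), where j = j] show ?thesis
    by (rule tendsto_unique[OF trivial_limit_at_right_real])
qed

section \<open>Smooth functions form an algebra\<close>

text \<open>Smoothness is the largest property of functions that implies differentiability and is preserved
  by partial derivatives. It is enough that each partial derivative agrees on \<open>S\<close> with a function
  that has the property, since differentiation rules hold only on \<open>S\<close>.\<close>

lemma smooth_on_coinduct: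
  assumes "open S" "P f"
    and step: "\<And>f. P f \<Longrightarrow> f differentiable_on S \<and> (\<forall>i. \<exists>g. P g \<and> (\<forall>u\<in>S. partial i f u = g u))"
  shows "smooth_on S f"
  unfolding smooth_on_def
proof
  fix "is" show "pd is f differentiable_on S"
    using \<open>P f\<close>
  proof (induction "is" arbitrary: f)
    case Nil
    then show ?case using step by simp
  next
    case (Cons i "is")
    obtain g where g: "P g" "\<And>u. u \<in> S \<Longrightarrow> partial i f u = g u"
      using step[OF Cons.prems] by blast
    have "pd (i # is) f u = pd is g u" if "u \<in> S" for u
      unfolding pd_Cons by (rule pd_cong[OF \<open>open S\<close> g(2) that])
    then show ?case
      using Cons.IH[OF g(1)] has_derivative_transform[where s = S and f = "pd is g" and g = "pd (i # is) f"]
      unfolding differentiable_on_def differentiable_def by metis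
  qed
qed

lemma smooth_on_pd: "smooth_on S f \<Longrightarrow> smooth_on S (pd is f)"
  by (simp add: smooth_on_def flip: pd_append)

lemma smooth_on_partial: "smooth_on S f \<Longrightarrow> smooth_on S (partial i f)"
  using smooth_on_pd[of S f "[i]"] by (simp add: pd_Cons)

lemma smooth_on_imp_differentiable_on: "smooth_on S f \<Longrightarrow> f differentiable_on S"
  by (metis pd_Nil smooth_on_def)

lemma smooth_on_imp_differentiable_at: "smooth_on S f \<Longrightarrow> open S \<Longrightarrow> p \<in> S \<Longrightarrow> f differentiable at p"
  using smooth_on_imp_differentiable_on differentiable_on_eq_differentiable_at by blast

text \<open>Closure of smooth functions under the arithmetic operations is proved for all operations at once:
  each differentiation rule expresses the derivative of a sum, product or reciprocal through the
  same operations, so the class generated by them is closed under partial derivatives.\<close>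

inductive smooth_expr :: "(real^'n::finite) set \<Rightarrow> (real^'n \<Rightarrow> real) \<Rightarrow> bool" for S where
  atom: "smooth_on S f \<Longrightarrow> smooth_expr S f"
| const: "smooth_expr S (\<lambda>u. c)"
| nth: "smooth_expr S (\<lambda>u. u $ j)"
| add: "smooth_expr S f \<Longrightarrow> smooth_expr S g \<Longrightarrow> smooth_expr S (\<lambda>u. f u + g u)"
| mult: "smooth_expr S f \<Longrightarrow> smooth_expr S g \<Longrightarrow> smooth_expr S (\<lambda>u. f u * g u)"
| inverse: "smooth_expr S f \<Longrightarrow> (\<And>u. u \<in> S \<Longrightarrow> f u \<noteq> 0) \<Longrightarrow> smooth_expr S (\<lambda>u. 1 / f u)"

lemma smooth_expr_step:
  assumes "open S" "smooth_expr S f"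
  shows "f differentiable_on S \<and> (\<forall>i. \<exists>g. smooth_expr S g \<and> (\<forall>u\<in>S. partial i f u = g u))"
  using assms(2)
proof induction
  case (atom f)
  then show ?case
    using smooth_expr.atom smooth_on_imp_differentiable_on smooth_on_partial by blast
next
  case (const c)
  then show ?case
    by (auto intro: smooth_expr.const)
next
  case (nth j)
  have "(\<lambda>u. u $ j) differentiable_on S"
    by (simp add: bounded_linear_imp_differentiable_on bounded_linear_vec_nth)
  then show ?case
    by (auto simp: partial_nth intro!: smooth_expr.const exI)
next
  case (add f g)
  then have "f differentiable at u" "g differentiable at u" if "u \<in> S" for u
    using that \<open>open S\<close> differentiable_on_eq_differentiable_at by blast+
  moreover obtain f' g' where "\<And>i. smooth_expr S (f' i)" "\<And>i u. u \<in> S \<Longrightarrow> partial i f u = f' i u"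
    "\<And>i. smooth_expr S (g' i)" "\<And>i u. u \<in> S \<Longrightarrow> partial i g u = g' i u"
    using add.IH by metis
  ultimately show ?case
    using add.IH
    by (auto simp: partial_add intro!: differentiable_on_add exI[of _ "\<lambda>u. f' _ u + g' _ u"] smooth_expr.add)
next
  case (mult f g)
  then have "f differentiable at u" "g differentiable at u" if "u \<in> S" for u
    using that \<open>open S\<close> differentiable_on_eq_differentiable_at by blast+
  moreover obtain f' g' where "\<And>i. smooth_expr S (f' i)" "\<And>i u. u \<in> S \<Longrightarrow> partial i f u = f' i u"
    "\<And>i. smooth_expr S (g' i)" "\<And>i u. u \<in> S \<Longrightarrow> partial i g u = g' i u"
    using mult.IH by metis
  ultimately show ?case
    using mult.IH mult.hyps
    by (auto simp: partial_mult intro!: differentiable_on_mult exI[of _ "\<lambda>u. f' _ u * g u + f u * g' _ u"]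
      smooth_expr.add smooth_expr.mult)
next
  case (inverse f)
  have d: "f differentiable at u" if "u \<in> S" for u
    using inverse that \<open>open S\<close> differentiable_on_eq_differentiable_at by blast
  have "\<exists>g. smooth_expr S g \<and> (\<forall>u\<in>S. partial i (\<lambda>u. 1 / f u) u = g u)" for i
  proof -
    obtain f' where f': "smooth_expr S f'" "\<And>u. u \<in> S \<Longrightarrow> partial i f u = f' u"
      using inverse by blast
    have "smooth_expr S (\<lambda>u. (-1) * f' u * (1 / f u * (1 / f u)))"
      using inverse f'(1) by (intro smooth_expr.mult smooth_expr.const smooth_expr.inverse)
    moreover have "partial i (\<lambda>u. 1 / f u) u = (-1) * f' u * (1 / f u * (1 / f u))" if "u \<in> S" for u
      using inverse that d[OF that] by (simp add: partial_divide f'(2) power2_eq_square)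
    ultimately show ?thesis by (intro exI conjI ballI)
  qed
  moreover have "(\<lambda>u. 1 / f u) differentiable_on S"
    using inverse.hyps d
    by (simp add: differentiable_on_eq_differentiable_at[OF \<open>open S\<close>] differentiable_divide)
  ultimately show ?case by blast
qed

lemma smooth_expr_iff: "open S \<Longrightarrow> smooth_expr S f \<longleftrightarrow> smooth_on S f"
  using smooth_on_coinduct[of S "smooth_expr S" f] smooth_expr_step[of S] smooth_expr.atom by blast

lemma smooth_on_const: "open S \<Longrightarrow> smooth_on S (\<lambda>u. c)"
  and smooth_on_nth: "open S \<Longrightarrow> smooth_on S (\<lambda>u. u $ j)"
  and smooth_on_add: "open S \<Longrightarrow> smooth_on S f \<Longrightarrow> smooth_on S g \<Longrightarrow> smooth_on S (\<lambda>u. f u + g u)"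
  and smooth_on_mult: "open S \<Longrightarrow> smooth_on S f \<Longrightarrow> smooth_on S g \<Longrightarrow> smooth_on S (\<lambda>u. f u * g u)"
  by (simp_all add: smooth_expr.intros flip: smooth_expr_iff)

lemma smooth_on_minus: "open S \<Longrightarrow> smooth_on S f \<Longrightarrow> smooth_on S (\<lambda>u. - f u)"
  using smooth_on_mult[OF _ smooth_on_const[of S "-1"], of f] by simp

lemma smooth_on_diff: "open S \<Longrightarrow> smooth_on S f \<Longrightarrow> smooth_on S g \<Longrightarrow> smooth_on S (\<lambda>u. f u - g u)"
  using smooth_on_add[OF _ _ smooth_on_minus, of S f g] by simp

lemma smooth_on_divide:
  "open S \<Longrightarrow> smooth_on S f \<Longrightarrow> smooth_on S g \<Longrightarrow> (\<And>u. u \<in> S \<Longrightarrow> g u \<noteq> 0) \<Longrightarrow>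
    smooth_on S (\<lambda>u. f u / g u)"
  using smooth_expr.mult[OF _ smooth_expr.inverse, of S f g] by (simp add: smooth_expr_iff)

lemma smooth_on_power: "open S \<Longrightarrow> smooth_on S f \<Longrightarrow> smooth_on S (\<lambda>u. f u ^ n)"
  by (induction n) (simp_all add: smooth_on_const smooth_on_mult)

lemmas smooth_on_intros = smooth_on_const smooth_on_nth smooth_on_add smooth_on_mult
  smooth_on_minus smooth_on_diff smooth_on_divide smooth_on_power

section \<open>The Ricci tensor as a contraction of Christoffel symbols\<close>

lemma matrix_inv_unique:
  fixes A B :: "real^'n::finite^'n"
  assumes "A ** B = mat 1"
  shows "matrix_inv A = B"
proof -
  have BA: "B ** A = mat 1"
    using assms matrix_left_right_inverse by blast
  then have "\<exists>C. A ** C = mat 1 \<and> C ** A = mat 1"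
    using assms by blast
  then have inv: "matrix_inv A ** A = mat 1"
    unfolding matrix_inv_def by (rule someI2_ex) simp
  have "matrix_inv A = matrix_inv A ** (A ** B)"
    using assms by simp
  also have "\<dots> = B"
    using inv by (simp add: matrix_mul_assoc)
  finally show ?thesis .
qed

text \<open>Lowering the first index of the curvature with \<open>g\<close> and contracting it with the inverse metric
  cancel, so that only the diagonal terms of the connection formula remain. No lowered
  curvature component has to be computed.\<close>

lemma ricci_eq_christoffel:
  fixes g :: "'n::finite tensor2"
  assumes "transpose (g u) = g u" "invertible (g u)"
  shows "ricci g u $ q $ r = (\<Sum>s\<in>UNIV.
      partial r (christoffel g s q s) u - partial s (christoffel g s q r) u
      + (\<Sum>\<beta>\<in>UNIV. christoffel g \<beta> q s u * christoffel g s \<beta> r u)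
      - (\<Sum>\<beta>\<in>UNIV. christoffel g \<beta> q r u * christoffel g s \<beta> s u))"
    (is "_ = (\<Sum>s\<in>UNIV. ?X s s)")
proof -
  obtain B where B: "g u ** B = mat 1"
    using assms(2) by (auto simp: invertible_def)
  define X where "X \<alpha> s = partial r (christoffel g \<alpha> q s) u - partial s (christoffel g \<alpha> q r) u
      + (\<Sum>\<beta>\<in>UNIV. christoffel g \<beta> q s u * christoffel g \<alpha> \<beta> r u)
      - (\<Sum>\<beta>\<in>UNIV. christoffel g \<beta> q r u * christoffel g \<alpha> \<beta> s u)" for \<alpha> s
  have sym: "g u $ p $ \<alpha> = g u $ \<alpha> $ p" for p \<alpha>
    using assms(1) by (metis transpose_def vec_lambda_beta)
  have "ricci g u $ q $ r = (\<Sum>p\<in>UNIV. \<Sum>s\<in>UNIV. \<Sum>\<alpha>\<in>UNIV. g u $ p $ \<alpha> * B $ p $ s * X \<alpha> s)"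
    unfolding ricci_def riemann_def matrix_inv_unique[OF B]
    by (simp add: sum_distrib_left mult.assoc mult.left_commute flip: X_def)
  also have "\<dots> = (\<Sum>s\<in>UNIV. \<Sum>p\<in>UNIV. \<Sum>\<alpha>\<in>UNIV. g u $ p $ \<alpha> * B $ p $ s * X \<alpha> s)"
    by (rule sum.swap)
  also have "\<dots> = (\<Sum>s\<in>UNIV. \<Sum>\<alpha>\<in>UNIV. \<Sum>p\<in>UNIV. g u $ p $ \<alpha> * B $ p $ s * X \<alpha> s)"
    by (intro sum.cong refl sum.swap)
  also have "\<dots> = (\<Sum>s\<in>UNIV. \<Sum>\<alpha>\<in>UNIV. (g u ** B) $ \<alpha> $ s * X \<alpha> s)"
    by (simp add: matrix_matrix_mult_def sym sum_distrib_right)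
  also have "\<dots> = (\<Sum>s\<in>UNIV. X s s)"
    unfolding B by (simp add: mat_def if_distrib[of "\<lambda>x. x * _"] cong: if_cong)
  finally show ?thesis
    unfolding X_def .
qed

section \<open>The Lie derivative along a constant vector field\<close>

lemma lie_derivative_constant_field:
  "lie_derivative (\<lambda>p. v) T p $ i $ j = (\<Sum>k\<in>UNIV. v $ k * partial k (\<lambda>u. T u $ i $ j) p)"
  by (simp add: lie_derivative_def)

section \<open>Functions of the transverse coordinates\<close>

lemma vector_4:
  "(vector [x, y, z, w] :: 'a::zero^4) $ 1 = x"
  "(vector [x, y, z, w] :: 'a::zero^4) $ 2 = y"
  "(vector [x, y, z, w] :: 'a::zero^4) $ 3 = z"
  "(vector [x, y, z, w] :: 'a::zero^4) $ 4 = w"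
  unfolding vector_def by simp_all

lemma xy_part_add_axis:
  "xy_part (p + h *\<^sub>R axis 1 1) = xy_part p"
  "xy_part (p + h *\<^sub>R axis 2 1) = xy_part p"
  "xy_part (p + h *\<^sub>R axis 3 1) = xy_part p + h *\<^sub>R axis 1 1"
  "xy_part (p + h *\<^sub>R axis 4 1) = xy_part p + h *\<^sub>R axis 2 1"
  by (simp_all add: xy_part_def vec_eq_iff forall_2 axis_def)

lemma partial_comp_xy_part:
  "partial 1 (\<lambda>u. h (xy_part u)) p = 0"
  "partial 2 (\<lambda>u. h (xy_part u)) p = 0"
  "partial 3 (\<lambda>u. h (xy_part u)) p = partial 1 h (xy_part p)"
  "partial 4 (\<lambda>u. h (xy_part u)) p = partial 2 h (xy_part p)"
  by (simp_all add: partial_def xy_part_add_axis)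

lemma bounded_linear_xy_part: "bounded_linear xy_part"
  unfolding linear_conv_bounded_linear[symmetric]
  by (rule linearI) (simp_all add: xy_part_def vec_eq_iff forall_2)

lemma differentiable_comp_xy_part:
  fixes p :: "real^4"
  shows "h differentiable at (xy_part p) \<Longrightarrow> (\<lambda>u. h (xy_part u)) differentiable at p"
  using differentiable_chain_at[OF bounded_linear_imp_differentiable[OF bounded_linear_xy_part], of h p]
  by (simp add: o_def)

lemma open_RT_manifold:
  assumes "open I" "open J" "open \<Omega>"
  shows "open (RT_manifold I J \<Omega>)"
proof -
  have "RT_manifold I J \<Omega> = (\<lambda>p. p $ 1) -` I \<inter> (\<lambda>p. p $ 2) -` J \<inter> xy_part -` \<Omega>"
    by (auto simp: RT_manifold_def)
  moreover have "continuous_on UNIV xy_part"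
    by (rule linear_continuous_on[OF bounded_linear_xy_part])
  ultimately show ?thesis
    using assms by (auto intro!: open_Int open_vimage continuous_intros)
qed

text \<open>Functions of the transverse coordinates are closed under partial derivatives: differentiation
  along \<open>t\<close> or \<open>r\<close> gives zero, and along \<open>x\<close> or \<open>y\<close> a planar derivative, so coinduction applies.\<close>

lemma smooth_on_comp_xy_part:
  assumes "open M" "open \<Omega>" "xy_part ` M \<subseteq> \<Omega>" "smooth_on \<Omega> h"
  shows "smooth_on M (\<lambda>p. h (xy_part p))"
proof (rule smooth_on_coinduct[where P = "\<lambda>u. \<exists>h. smooth_on \<Omega> h \<and> u = (\<lambda>p. h (xy_part p))"])
  show "open M" by fact
  show "\<exists>h'. smooth_on \<Omega> h' \<and> (\<lambda>p. h (xy_part p)) = (\<lambda>p. h' (xy_part p))"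
    using assms(4) by blast
next
  fix u assume "\<exists>h. smooth_on \<Omega> h \<and> u = (\<lambda>p. h (xy_part p))"
  then obtain h where h: "smooth_on \<Omega> h" "u = (\<lambda>p. h (xy_part p))" by blast
  have "u differentiable at p" if "p \<in> M" for p
    using smooth_on_imp_differentiable_at[OF h(1) \<open>open \<Omega>\<close>] that assms(3)
    by (auto simp: h(2) intro: differentiable_comp_xy_part)
  then have "u differentiable_on M"
    by (simp add: differentiable_on_eq_differentiable_at[OF \<open>open M\<close>])
  moreover have "\<exists>h'. smooth_on \<Omega> h' \<and> partial i u = (\<lambda>p. h' (xy_part p))" for i
  proof -
    have "partial i u = (\<lambda>p. (if i = 1 \<or> i = 2 then (\<lambda>q. 0) else if i = 3 then partial 1 h else partial 2 h) (xy_part p))"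
      using exhaust_4[of i] by (auto simp: h(2) partial_comp_xy_part fun_eq_iff)
    moreover have "smooth_on \<Omega> (if i = 1 \<or> i = 2 then (\<lambda>q. 0) else if i = 3 then partial 1 h else partial 2 h)"
      using smooth_on_partial[OF h(1)] smooth_on_const[OF \<open>open \<Omega>\<close>] by simp
    ultimately show ?thesis by blast
  qed
  ultimately show "u differentiable_on M \<and>
      (\<forall>i. \<exists>g. (\<exists>h. smooth_on \<Omega> h \<and> g = (\<lambda>p. h (xy_part p))) \<and> (\<forall>p\<in>M. partial i u p = g p))"
    by metis
qed

section \<open>Curvature of the Robinson--Trautman metric\<close>

text \<open>The entry at \<open>k, i, j\<close> is $\Gamma^k_{ij}$. Here \<open>A\<close> is the metric coefficient $g_{11}$ and \<open>A'\<close> its derivative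
  in \<open>r\<close>; \<open>u\<close> and \<open>v\<close> are the logarithmic derivatives of \<open>f\<close>, which make up the connection of the
  conformally flat transverse metric.\<close>

definition RT_christoffel :: "real \<Rightarrow> real \<Rightarrow> real \<Rightarrow> (real^2 \<Rightarrow> real) \<Rightarrow> real^4 \<Rightarrow> real^4^4^4" where
  "RT_christoffel a b d f p =
     (let r = p $ 2; q = xy_part p;
          A = - 2 * (a - 2 * b * r - d / r); A' = 4 * b - 2 * d / r\<^sup>2;
          k = r / (f q)\<^sup>2; u = pd [1] f q / f q; v = pd [2] f q / f q in
      vector [
        vector [vector [- A' / 2, 0, 0, 0],
                vector [0, 0, 0, 0],
                vector [0, 0, k, 0],
                vector [0, 0, 0, k]],
        vector [vector [A * A' / 2, A' / 2, 0, 0],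
                vector [A' / 2, 0, 0, 0],
                vector [0, 0, - A * k, 0],
                vector [0, 0, 0, - A * k]],
        vector [vector [0, 0, 0, 0],
                vector [0, 0, 1 / r, 0],
                vector [0, 1 / r, - u, - v],
                vector [0, 0, - v, u]],
        vector [vector [0, 0, 0, 0],
                vector [0, 0, 0, 1 / r],
                vector [0, 0, v, - u],
                vector [0, 1 / r, - u, - v]]])"

text \<open>The common value of $S_{33}$ and $S_{44}$, named because it is the only Ricci component that depends on
  \<open>x\<close> and \<open>y\<close>.\<close>

definition RT_transverse_ricci :: "real \<Rightarrow> real \<Rightarrow> (real^2 \<Rightarrow> real) \<Rightarrow> real^4 \<Rightarrow> real" where
  "RT_transverse_ricci a b f p = (RT_F1 f (xy_part p) - 2 * a + 8 * b * p $ 2) / (f (xy_part p))\<^sup>2"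

definition RT_ricci :: "real \<Rightarrow> real \<Rightarrow> real \<Rightarrow> (real^2 \<Rightarrow> real) \<Rightarrow> 4 tensor2" where
  "RT_ricci a b d f p =
     (let r = p $ 2; h = RT_transverse_ricci a b f p in
      vector [vector [- (8 * b * (d + r * (- a + 2 * b * r)) / r\<^sup>2), - (4 * b / r), 0, 0],
              vector [- (4 * b / r), 0, 0, 0],
              vector [0, 0, h, 0],
              vector [0, 0, 0, h]])"

definition RT_inverse_metric :: "real \<Rightarrow> real \<Rightarrow> real \<Rightarrow> (real^2 \<Rightarrow> real) \<Rightarrow> 4 tensor2" where
  "RT_inverse_metric a b d f p =
     (let r = p $ 2; h = - ((f (xy_part p))\<^sup>2 / r\<^sup>2) in
      vector [vector [0, 1, 0, 0],
              vector [1, 2 * (a - 2 * b * r - d / r), 0, 0],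
              vector [0, 0, h, 0],
              vector [0, 0, 0, h]])"

locale robinson_trautman =
  fixes a b d :: real and I J :: "real set" and \<Omega> :: "(real^2) set" and f :: "real^2 \<Rightarrow> real"
  assumes open_I: "open I" and open_J: "open J" and zero_notin_J: "0 \<notin> J"
    and open_\<Omega>: "open \<Omega>"
    and smooth_f: "smooth_on \<Omega> f"
    and f_nonzero: "q \<in> \<Omega> \<Longrightarrow> f q \<noteq> 0"
begin

abbreviation "M \<equiv> RT_manifold I J \<Omega>"
abbreviation "g \<equiv> RT_metric a b d f"
abbreviation "G \<equiv> RT_christoffel a b d f"

lemma open_M: "open M"
  using open_I open_J open_\<Omega> by (rule open_RT_manifold)

lemma M_D:
  assumes "p \<in> M"
  shows "p $ 2 \<noteq> 0" "xy_part p \<in> \<Omega>" "f (xy_part p) \<noteq> 0"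
  using assms zero_notin_J f_nonzero by (auto simp: RT_manifold_def)

lemma differentiable_pd: "q \<in> \<Omega> \<Longrightarrow> pd is f differentiable at q"
  by (rule smooth_on_imp_differentiable_at[OF smooth_on_pd[OF smooth_f] open_\<Omega>])

lemma pd_commute:
  assumes "q \<in> \<Omega>"
  shows "pd (is @ [i, j] @ js) f q = pd (is @ [j, i] @ js) f q"
proof -
  have "pd js (pd [i, j] (pd is f)) q = pd js (pd [j, i] (pd is f)) q"
  proof (rule pd_cong[OF open_\<Omega> _ assms])
    fix u assume u: "u \<in> \<Omega>"
    have "partial j (partial i (pd is f)) u = partial i (partial j (pd is f)) u"
      using u differentiable_pd by (intro partial_commute[OF open_\<Omega> u]) (auto simp: partial_pd)
    then show "pd [i, j] (pd is f) u = pd [j, i] (pd is f) u"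
      by (simp add: pd_Cons)
  qed
  then show ?thesis by (simp only: pd_append)
qed

lemma f_differentiable: "q \<in> \<Omega> \<Longrightarrow> f differentiable at q"
  using differentiable_pd[of q "[]"] by simp

lemma partial_f_xy_part:
  "partial 1 (\<lambda>u. f (xy_part u)) p = 0"
  "partial 2 (\<lambda>u. f (xy_part u)) p = 0"
  "partial 3 (\<lambda>u. f (xy_part u)) p = pd [1] f (xy_part p)"
  "partial 4 (\<lambda>u. f (xy_part u)) p = pd [2] f (xy_part p)"
  by (simp_all add: partial_comp_xy_part pd_Cons)

lemma partial_pd_xy_part:
  "partial 1 (\<lambda>u. pd is f (xy_part u)) p = 0"
  "partial 2 (\<lambda>u. pd is f (xy_part u)) p = 0"
  "partial 3 (\<lambda>u. pd is f (xy_part u)) p = pd (is @ [1]) f (xy_part p)"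
  "partial 4 (\<lambda>u. pd is f (xy_part u)) p = pd (is @ [2]) f (xy_part p)"
  by (simp_all add: partial_comp_xy_part partial_pd)

lemma differentiable_nth: "(\<lambda>u. u $ j) differentiable at p"
  by (rule bounded_linear_imp_differentiable[OF bounded_linear_vec_nth])

lemmas partial_simps = partial_nth partial_add partial_diff partial_minus partial_mult
  partial_divide partial_power2 partial_f_xy_part partial_pd_xy_part
  differentiable_nth f_differentiable differentiable_pd differentiable_comp_xy_part
  differentiable_divide differentiable_power

lemma matrix_inv_metric:
  assumes "p \<in> M"
  shows "matrix_inv (g p) = RT_inverse_metric a b d f p" "invertible (g p)" "transpose (g p) = g p"
proof -
  have *: "g p ** RT_inverse_metric a b d f p = mat 1"
    using M_D[OF assms]
    by (simp add: RT_metric_def RT_inverse_metric_def Let_def matrix_matrix_mult_def vec_eq_iff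
        forall_4 sum_4 vector_4 mat_def field_simps)
  then show "matrix_inv (g p) = RT_inverse_metric a b d f p"
    by (rule matrix_inv_unique)
  show "invertible (g p)"
    using * matrix_left_right_inverse unfolding invertible_def by blast
  show "transpose (g p) = g p"
    by (simp add: RT_metric_def Let_def transpose_def vec_eq_iff forall_4 vector_4)
qed

lemma christoffel_eq:
  assumes "p \<in> M"
  shows "christoffel g k i j p = G p $ k $ i $ j"
proof -
  note [simp] = M_D[OF assms] partial_simps
  have "\<forall>k i j. christoffel g k i j p = G p $ k $ i $ j"
    unfolding christoffel_def matrix_inv_metric(1)[OF assms]
    by (simp add: forall_4 sum_4 RT_metric_def RT_inverse_metric_def RT_christoffel_def Let_def vector_4)
       (simp add: field_simps power2_eq_square power4_eq_xxxx)
  then show ?thesis by blast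
qed

lemma partial_christoffel:
  assumes "p \<in> M"
  shows "partial l (christoffel g k i j) p = partial l (\<lambda>u. G u $ k $ i $ j) p"
  by (rule partial_cong[OF open_M assms christoffel_eq])

lemma ricci_eq:
  assumes "p \<in> M"
  shows "ricci g p = RT_ricci a b d f p"
proof -
  note [simp] = M_D[OF assms] partial_simps
  \<comment> \<open>The off-diagonal transverse component vanishes only after the two mixed derivatives of \<open>f\<close> cancel.\<close>
  have [simp]: "pd [2, 1] f (xy_part p) = pd [1, 2] f (xy_part p)"
    using pd_commute[OF M_D(2)[OF assms], of "[]" 2 1 "[]"] by simp
  have "\<forall>q r. ricci g p $ q $ r = RT_ricci a b d f p $ q $ r"
    unfolding ricci_eq_christoffel[of g, OF matrix_inv_metric(3,2)[OF assms]]
      partial_christoffel[OF assms] christoffel_eq[OF assms]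
    by (simp add: forall_4 sum_4 RT_christoffel_def RT_ricci_def RT_transverse_ricci_def RT_F1_def Let_def vector_4)
       (simp add: field_simps power2_eq_square power4_eq_xxxx)
  then show ?thesis by (simp add: vec_eq_iff)
qed

section \<open>Generalized Ricci inheritance\<close>

lemma partial_ricci:
  assumes "p \<in> M"
  shows "partial k (\<lambda>u. ricci g u $ i $ j) p = partial k (\<lambda>u. RT_ricci a b d f u $ i $ j) p"
  by (rule partial_cong[OF open_M assms]) (simp add: ricci_eq)

text \<open>\<^const>\<open>RT_F11\<close> and \<^const>\<open>RT_F13\<close> are the numerators that the quotient rule produces for the two
  transverse derivatives of $S_{33}$. Differentiating \<^const>\<open>RT_F1\<close> along $x$ yields $f_{yx}$ and $f_{yyx}$, where
  \<^const>\<open>RT_F11\<close> has $f_{xy}$ and $f_{xyy}$, hence the interchange of mixed derivatives.\<close>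

lemma transverse_ricci_partials:
  assumes "p \<in> M"
  shows "partial 3 (RT_transverse_ricci a b f) p
      = RT_F11 a b f (p $ 2) (xy_part p) / f (xy_part p) ^ 3"
    and "partial 4 (RT_transverse_ricci a b f) p
      = RT_F13 a b f (p $ 2) (xy_part p) / f (xy_part p) ^ 3"
proof -
  note [simp] = M_D[OF assms] partial_simps
  note pdc = pd_commute[OF M_D(2)[OF assms]]
  have [simp]: "pd [2, 1] f (xy_part p) = pd [1, 2] f (xy_part p)"
    "pd [2, 2, 1] f (xy_part p) = pd [1, 2, 2] f (xy_part p)"
    using pdc[of "[]" 2 1 "[]"] pdc[of "[2]" 2 1 "[]"] pdc[of "[]" 2 1 "[2]"] by simp_all
  show "partial 3 (RT_transverse_ricci a b f) p
      = RT_F11 a b f (p $ 2) (xy_part p) / f (xy_part p) ^ 3"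
    unfolding RT_transverse_ricci_def[abs_def] RT_F1_def RT_F11_def
    by (simp, simp add: field_simps power2_eq_square power3_eq_cube power4_eq_xxxx)
  show "partial 4 (RT_transverse_ricci a b f) p
      = RT_F13 a b f (p $ 2) (xy_part p) / f (xy_part p) ^ 3"
    unfolding RT_transverse_ricci_def[abs_def] RT_F1_def RT_F13_def
    by (simp, simp add: field_simps power2_eq_square power3_eq_cube power4_eq_xxxx)
qed

lemma lie_derivative_ricci:
  assumes "p \<in> M"
  shows "lie_derivative (\<lambda>p. \<mu>1 *\<^sub>R axis 3 1 + \<mu>2 *\<^sub>R axis 4 1) (ricci g) p $ i $ j =
    (if i = j \<and> (i = 3 \<or> i = 4)
     then (\<mu>2 * RT_F13 a b f (p $ 2) (xy_part p) + \<mu>1 * RT_F11 a b f (p $ 2) (xy_part p)) / f (xy_part p) ^ 3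
     else 0)"
proof -
  note [simp] = M_D[OF assms] partial_simps
  have T: "RT_ricci a b d f u $ 3 $ 3 = RT_transverse_ricci a b f u"
    "RT_ricci a b d f u $ 4 $ 4 = RT_transverse_ricci a b f u" for u
    by (simp_all add: RT_ricci_def Let_def vector_4)
  have "\<forall>i j. lie_derivative (\<lambda>p. \<mu>1 *\<^sub>R axis 3 1 + \<mu>2 *\<^sub>R axis 4 1) (ricci g) p $ i $ j =
    (if i = j \<and> (i = 3 \<or> i = 4)
     then (\<mu>2 * RT_F13 a b f (p $ 2) (xy_part p) + \<mu>1 * RT_F11 a b f (p $ 2) (xy_part p)) / f (xy_part p) ^ 3
     else 0)"
    unfolding lie_derivative_constant_field partial_ricci[OF assms]
    by (simp add: forall_4 sum_4 T axis_def transverse_ricci_partials[OF assms])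
       (simp add: RT_ricci_def Let_def vector_4 add_divide_distrib)
  then show ?thesis by blast
qed

lemma smooth_on_M:
  "smooth_on M (\<lambda>p. f (xy_part p))"
  "smooth_on M (\<lambda>p. pd is f (xy_part p))"
proof -
  have "xy_part ` M \<subseteq> \<Omega>" by (auto simp: RT_manifold_def)
  note comp = smooth_on_comp_xy_part[OF open_M open_\<Omega> this]
  show "smooth_on M (\<lambda>p. f (xy_part p))" by (rule comp[OF smooth_f])
  show "smooth_on M (\<lambda>p. pd is f (xy_part p))" by (rule comp[OF smooth_on_pd[OF smooth_f]])
qed

text \<open>Taking $\lambda_g = \frac{4b}{r}\lambda_S$ removes the \<open>t, r\<close> block, where $S = -\frac{4b}{r}g$. On the
  transverse block $\lambda_S S + \lambda_g g$ is then $\lambda_S (F_1 - 2a + 4br)/f^2$, and the nonvanishing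
  of this numerator is what permits solving for $\lambda_S$.\<close>

lemma generalized_ricci_inheritance_transverse:
  assumes nz: "\<And>p. p \<in> M \<Longrightarrow> RT_F1 f (xy_part p) - 2 * a + 4 * b * p $ 2 \<noteq> 0"
  shows "generalized_ricci_inheritance M g
           (\<lambda>p. \<mu>1 *\<^sub>R axis 3 1 + \<mu>2 *\<^sub>R axis 4 1)
           (\<lambda>p. let r = p $ 2; q = xy_part p in
              - ((\<mu>2 * RT_F13 a b f r q + \<mu>1 * RT_F11 a b f r q)
                 / (f q * (2 * a - 4 * b * r - RT_F1 f q))))
           (\<lambda>p. let r = p $ 2; q = xy_part p in
              - ((4 * b * (\<mu>2 * RT_F13 a b f r q + \<mu>1 * RT_F11 a b f r q))
                 / (r * f q * (2 * a - 4 * b * r - RT_F1 f q))))"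
  unfolding generalized_ricci_inheritance_def Let_def
proof (intro conjI ballI)
  have nz': "2 * a - 4 * b * p $ 2 \<noteq> RT_F1 f (xy_part p)" if "p \<in> M" for p
    using nz[OF that] by simp
  have F1: "smooth_on M (\<lambda>p. RT_F1 f (xy_part p))"
    unfolding RT_F1_def by (intro smooth_on_intros[OF open_M] smooth_on_M)
  have F13: "smooth_on M (\<lambda>p. RT_F13 a b f (p $ 2) (xy_part p))"
    unfolding RT_F13_def by (intro smooth_on_intros[OF open_M] smooth_on_M)
  have F11: "smooth_on M (\<lambda>p. RT_F11 a b f (p $ 2) (xy_part p))"
    unfolding RT_F11_def by (intro smooth_on_intros[OF open_M] smooth_on_M)
  show "smooth_on M (\<lambda>p. - ((\<mu>2 * RT_F13 a b f (p $ 2) (xy_part p) + \<mu>1 * RT_F11 a b f (p $ 2) (xy_part p))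
                 / (f (xy_part p) * (2 * a - 4 * b * p $ 2 - RT_F1 f (xy_part p)))))"
    by (intro smooth_on_intros[OF open_M] smooth_on_M F1 F13 F11) (simp add: M_D nz')
  show "smooth_on M (\<lambda>p. - ((4 * b * (\<mu>2 * RT_F13 a b f (p $ 2) (xy_part p) + \<mu>1 * RT_F11 a b f (p $ 2) (xy_part p)))
                 / (p $ 2 * f (xy_part p) * (2 * a - 4 * b * p $ 2 - RT_F1 f (xy_part p)))))"
    by (intro smooth_on_intros[OF open_M] smooth_on_M F1 F13 F11) (simp add: M_D nz')
  fix p assume p: "p \<in> M"
  define N where "N = \<mu>2 * RT_F13 a b f (p $ 2) (xy_part p) + \<mu>1 * RT_F11 a b f (p $ 2) (xy_part p)"
  define F1 where "F1 = RT_F1 f (xy_part p)"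
  define r where "r = p $ 2"
  define \<phi> where "\<phi> = f (xy_part p)"
  define E where "E = 2 * a - 4 * b * r - F1"
  have [simp]: "r \<noteq> 0" "\<phi> \<noteq> 0" "E \<noteq> 0"
    using M_D[OF p] nz'[OF p] by (simp_all add: r_def \<phi>_def E_def F1_def)
  define \<sigma> where "\<sigma> = - (N / (\<phi> * E))"
  have lg: "- (4 * b * N / (r * \<phi> * E)) = (4 * b / r) * \<sigma>"
    by (simp add: \<sigma>_def)
  have transverse: "\<sigma> * ((F1 - 2 * a + 8 * b * r) / \<phi>\<^sup>2) + 4 * b / r * \<sigma> * - (r\<^sup>2 / \<phi>\<^sup>2) = N / \<phi> ^ 3"
  proof -
    have "\<sigma> * ((F1 - 2 * a + 8 * b * r) / \<phi>\<^sup>2) + 4 * b / r * \<sigma> * - (r\<^sup>2 / \<phi>\<^sup>2) = \<sigma> * (- E / \<phi>\<^sup>2)"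
      by (simp add: E_def field_simps power2_eq_square)
    then show ?thesis
      by (simp add: \<sigma>_def power2_eq_square power3_eq_cube)
  qed
  have "\<forall>i j. lie_derivative (\<lambda>p. \<mu>1 *\<^sub>R axis 3 1 + \<mu>2 *\<^sub>R axis 4 1) (ricci g) p $ i $ j =
      (\<sigma> *\<^sub>R ricci g p + (4 * b / r * \<sigma>) *\<^sub>R g p) $ i $ j"
    unfolding lie_derivative_ricci[OF p] ricci_eq[OF p] N_def[symmetric] \<phi>_def[symmetric]
    by (simp add: forall_4 RT_ricci_def RT_transverse_ricci_def RT_metric_def Let_def vector_4 flip: r_def \<phi>_def F1_def)
       (use transverse in \<open>simp add: field_simps power2_eq_square\<close>)
  then show "lie_derivative (\<lambda>p. \<mu>1 *\<^sub>R axis 3 1 + \<mu>2 *\<^sub>R axis 4 1) (ricci g) p =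
      - ((\<mu>2 * RT_F13 a b f (p $ 2) (xy_part p) + \<mu>1 * RT_F11 a b f (p $ 2) (xy_part p))
         / (f (xy_part p) * (2 * a - 4 * b * p $ 2 - RT_F1 f (xy_part p)))) *\<^sub>R ricci g p
      + - ((4 * b * (\<mu>2 * RT_F13 a b f (p $ 2) (xy_part p) + \<mu>1 * RT_F11 a b f (p $ 2) (xy_part p)))
         / (p $ 2 * f (xy_part p) * (2 * a - 4 * b * p $ 2 - RT_F1 f (xy_part p)))) *\<^sub>R g p"
    unfolding N_def[symmetric]
    unfolding r_def[symmetric] \<phi>_def[symmetric] F1_def[symmetric] E_def[symmetric]
      lg \<sigma>_def[symmetric] vec_eq_iff by blast
qed

end

theorem proposition4p1:
  fixes a b d \<mu>1 \<mu>2 :: real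
    and I J :: "real set"
    and \<Omega> :: "(real^2) set"
    and f :: "real^2 \<Rightarrow> real"
  assumes "open I" "is_interval I" "I \<noteq> {}"
    and "open J" "is_interval J" "J \<noteq> {}" "0 \<notin> J"
    and "open \<Omega>" "connected \<Omega>" "\<Omega> \<noteq> {}"
    and "smooth_on \<Omega> f"
    and "\<And>q. q \<in> \<Omega> \<Longrightarrow> f q \<noteq> 0"
    and "\<And>p. p \<in> RT_manifold I J \<Omega> \<Longrightarrow> RT_F1 f (xy_part p) - 2 * a + 4 * b * p $ 2 \<noteq> 0"
  shows "generalized_ricci_inheritance (RT_manifold I J \<Omega>) (RT_metric a b d f)
           (\<lambda>p. \<mu>1 *\<^sub>R axis 3 1 + \<mu>2 *\<^sub>R axis 4 1)
           (\<lambda>p. let r = p $ 2; q = xy_part p in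
              - ((\<mu>2 * RT_F13 a b f r q + \<mu>1 * RT_F11 a b f r q)
                 / (f q * (2 * a - 4 * b * r - RT_F1 f q))))
           (\<lambda>p. let r = p $ 2; q = xy_part p in
              - ((4 * b * (\<mu>2 * RT_F13 a b f r q + \<mu>1 * RT_F11 a b f r q))
                 / (r * f q * (2 * a - 4 * b * r - RT_F1 f q))))"
proof -
  interpret robinson_trautman a b d I J \<Omega> f
    using assms by unfold_locales auto
  show ?thesis
    using assms(13) by (rule generalized_ricci_inheritance_transverse)
qed

end
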